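(* Let $p$ be a prime and let $\nu$ be a positive integer. Let $A$ be a finite abelian group such that $p\nmid |A|$ and let $P$ be a finite abelian $p$-group. Let $r_I$ be the number of $p^\nu$-cyclotomic classes of $A$ of type $I$ and let $2r_{II}$ be the number of $p^\nu$-cyclotomic classes of $A$ of type $II$. Then the number of Euclidean complementary dual abelian codes in $\mathbb{F}_{p^\nu}[A\times P]$ is $2^{r_I+r_{II}}$.
   Context: For a finite field $F$ and a finite abelian group $G$ (written additively), an abelian code in the group algebra $F[G]$ is an ideal of $F[G]$. For $u=\sum_g u_gY^g$, $v=\sum_g v_gY^g$ in $F[G]$, $\langle u,v\rangle_{\rm E}=\sum_g u_gv_g$; $C^{\perp_{\rm E}}=\{v : \langle c,v\rangle_{\rm E}=0\ \forall c\in C\}$; $C$ is Euclidean complementary dual if $C\cap C^{\perp_{\rm E}}=\{0\}$. For $a\in A$, $S_{p^\nu}(a)=\{p^{\nu i}\cdot a : i\ge 0\}$ is the $p^\nu$-cyclotomic class of $a$ (these classes partition $A$); it is of type $I$ if $S_{p^\nu}(a)=S_{p^\nu}(-a)$ and of type $II$ otherwise. Classes of type $II$ come in pairs $S_{p^\nu}(a)\ne S_{p^\nu}(-a)$, so their number is even. *)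

theory Defs
  imports
    "HOL-Library.Poly_Mapping"
    "HOL-Library.Product_Plus"
    "HOL-Library.Cardinality"
    "HOL-Algebra.Algebraic_Closure_Type"
begin

text \<open>
  For a finite group \<open>'g\<close>, written additively, every function from \<open>'g\<close> to the field is finitely
  supported, so the ring \<open>'g \<Rightarrow>\<^sub>0 'f\<close> with its convolution product is the group algebra:
  \<open>Poly_Mapping.single g c\<close> is \<open>c Y\<^sup>g\<close>, and \<open>Poly_Mapping.lookup u g\<close> is the coefficient of \<open>Y\<^sup>g\<close> in \<open>u\<close>.
\<close>

type_synonym ('f, 'g) group_algebra = "'g \<Rightarrow>\<^sub>0 'f"

definition abelian_code ::
    "('f::{field, finite}, 'g::{ab_group_add, finite}) group_algebra set \<Rightarrow> bool" where
  "abelian_code C \<longleftrightarrow> ideal C ring_of_type_algebra"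

definition euclidean_inner ::
    "('f::{field, finite}, 'g::{ab_group_add, finite}) group_algebra \<Rightarrow> ('f, 'g) group_algebra \<Rightarrow> 'f"
  where "euclidean_inner u v = (\<Sum>g\<in>UNIV. Poly_Mapping.lookup u g * Poly_Mapping.lookup v g)"

definition euclidean_dual ::
    "('f::{field, finite}, 'g::{ab_group_add, finite}) group_algebra set \<Rightarrow> ('f, 'g) group_algebra set"
  where "euclidean_dual C = {v. \<forall>c\<in>C. euclidean_inner c v = 0}"

definition euclidean_complementary_dual ::
    "('f::{field, finite}, 'g::{ab_group_add, finite}) group_algebra set \<Rightarrow> bool" where
  "euclidean_complementary_dual C \<longleftrightarrow> C \<inter> euclidean_dual C = {0}"

definition nat_mult :: "nat \<Rightarrow> 'a::ab_group_add \<Rightarrow> 'a" where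
  "nat_mult n a = (\<Sum>j<n. a)"

definition cyclotomic_class :: "nat \<Rightarrow> 'a::ab_group_add \<Rightarrow> 'a set" where
  "cyclotomic_class q a = {nat_mult (q ^ i) a | i. True}"

text \<open>
  The type of a class does not depend on the representative \<open>a\<close>. Both collections below are sets
  of classes, so their cardinalities count classes and not representatives.
\<close>

definition type_I_classes :: "nat \<Rightarrow> 'a::ab_group_add set set" where
  "type_I_classes q =
     {cyclotomic_class q a | a. cyclotomic_class q a = cyclotomic_class q (- a)}"

definition type_II_classes :: "nat \<Rightarrow> 'a::ab_group_add set set" where
  "type_II_classes q =
     {cyclotomic_class q a | a. cyclotomic_class q a \<noteq> cyclotomic_class q (- a)}"

lemma abelian_code_iff:
  fixes C :: "('f::{field, finite}, 'g::{ab_group_add, finite}) group_algebra set"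
  shows "abelian_code C \<longleftrightarrow>
    0 \<in> C \<and> (\<forall>u\<in>C. \<forall>v\<in>C. u + v \<in> C) \<and> (\<forall>r. \<forall>u\<in>C. r * u \<in> C)"
  (is "?L \<longleftrightarrow> ?R")
proof
  let ?K = "ring_of_type_algebra :: ('f, 'g) group_algebra ring"
  assume ?L
  then interpret I: ideal C ?K by (simp add: abelian_code_def)
  show ?R
    using additive_subgroup.zero_closed[OF I.is_additive_subgroup]
      additive_subgroup.a_closed[OF I.is_additive_subgroup] I.I_l_closed
    by (auto simp: ring_of_type_algebra_def)
next
  let ?K = "ring_of_type_algebra :: ('f, 'g) group_algebra ring"
  assume R: ?R
  have neg: "- u \<in> C" if "u \<in> C" for u
  proof -
    have "(- 1) * u \<in> C" using R that by blast
    then show ?thesis by simp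
  qed
  interpret K: ring ?K by (rule ring_from_type_algebra)
  have minus: "inv\<^bsub>add_monoid ?K\<^esub> u = - u" for u
    unfolding a_inv_def[symmetric]
    by (rule K.minus_equality) (simp_all add: ring_of_type_algebra_def)
  have "subgroup C (add_monoid ?K)"
    by (rule group.subgroupI[OF K.a_group], unfold minus)
       (use R neg in \<open>auto simp: ring_of_type_algebra_def\<close>)
  moreover have "u * r \<in> C" if "u \<in> C" for u r
    using R that by (simp add: mult.commute[of u r])
  ultimately have "ideal C ?K"
    by (intro idealI K.ring_axioms)
       (use R in \<open>auto simp: ring_of_type_algebra_def\<close>)
  then show ?L by (simp add: abelian_code_def)
qed

end

(* Write bar for the automorphism Y^g |-> Y^(-g) of F[G]. Since <u, v> is the coefficient of Y^0 in
   u * bar v, the dual of an ideal C is the conjugate of its annihilator. If C meets its dual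
   trivially, nondegeneracy of the form gives 1 = e + f with e in C and f in the dual, and then e is
   an idempotent with bar e = e and C = e F[G]. So one counts the idempotents fixed by bar.

   They all lie in the F-algebra B of elements u with u^q = u and bar u = u, where q = |F|. In any
   such algebra of size q^n there are 2^n idempotents: e B splits as long as e is not primitive, and
   for e primitive the factorisation of X^q - X over F forces e B = F e. Finally u^q = u means that u
   is supported on A x 0 (raise to a power of q that kills P and is the identity on A) and constant
   on q-cyclotomic classes, so n is the number of unions of a class with its negative. *)
theory Submission
  imports Defs
begin

section \<open>Idempotents of finite algebras over a field with q elements in which x^q = x\<close>

section \<open>Counting idempotents\<close>

text \<open>Multiplication by a nonzero \<open>c\<close> permutes the nonzero elements, so
  \<open>c ^ (q - 1)\<close> times their product is that product again.\<close>

lemma finite_field_power_card: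
  fixes c :: "'f::{field, finite}"
  shows "c ^ CARD('f) = c"
proof (cases "c = 0")
  case False
  let ?P = "\<Prod>(UNIV - {0::'f})"
  have "c ^ (CARD('f) - 1) * ?P = (\<Prod>y\<in>UNIV-{0}. c * y)"
    by (simp add: prod.distrib)
  also have "\<dots> = ?P"
    by (rule prod.reindex_bij_witness[of _ "\<lambda>y. y / c" "\<lambda>y. c * y"]) (use False in auto)
  finally have "c ^ (CARD('f) - 1) = 1" by simp
  then show ?thesis
    by (metis mult.right_neutral power_eq_if zero_less_card_finite less_irrefl)
qed simp

text \<open>Both sides have degree at most q, the same coefficient at X^q, and the value 0 at each
  of the q field elements. As q \<ge> 2, subtracting X does not touch the top coefficient.\<close>

lemma prod_linear_factors_finite_field:
  "(\<Prod>c\<in>UNIV. [:- c, 1:]) = Polynomial.monom 1 CARD('f) - [:0, 1 :: 'f::{field, finite}:]"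
proof (rule poly_eqI_degree_lead_coeff[where n = "CARD('f)" and A = UNIV])
  have q: "CARD('f) \<ge> 2"
    using card_mono[of UNIV "{0, 1::'f}"] by simp
  have deg: "degree (\<Prod>c\<in>UNIV. [:- c, 1 :: 'f:]) = CARD('f)"
    by (subst degree_prod_eq_sum_degree) auto
  then show "degree (\<Prod>c\<in>UNIV. [:- c, 1 :: 'f:]) \<le> CARD('f)"
    by simp
  show "degree (Polynomial.monom 1 CARD('f) - [:0, 1 :: 'f:]) \<le> CARD('f)"
    using q by (intro degree_diff_le) (auto simp: degree_monom_eq)
  have "lead_coeff (\<Prod>c\<in>UNIV. [:- c, 1 :: 'f:]) = 1"
    by (simp add: lead_coeff_prod)
  then show "coeff (\<Prod>c\<in>UNIV. [:- c, 1 :: 'f:]) CARD('f)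
      = coeff (Polynomial.monom 1 CARD('f) - [:0, 1 :: 'f:]) CARD('f)"
    using q deg by (simp add: coeff_pCons split: nat.splits)
  show "poly (\<Prod>c\<in>UNIV. [:- c, 1:]) z = poly (Polynomial.monom 1 CARD('f) - [:0, 1 :: 'f:]) z"
    for z :: 'f
    by (simp add: poly_prod poly_monom finite_field_power_card prod_zero_iff)
qed auto

text \<open>Scalars enter through a map \<open>\<iota>\<close> into an ambient ring and the algebra
  is a set \<open>B\<close>, not a type, because it is later the set of common fixed points of two
  maps on the group algebra.\<close>

locale frobenius_fixed_subalgebra =
  fixes \<iota> :: "'f::{field, finite} \<Rightarrow> 'r::comm_ring_1" and B :: "'r set"
  assumes finite_B: "finite B"
    and \<iota>_one: "\<iota> 1 = 1"
    and \<iota>_add: "\<iota> (c + d) = \<iota> c + \<iota> d"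
    and \<iota>_mult: "\<iota> (c * d) = \<iota> c * \<iota> d"
    and \<iota>_mem: "\<iota> c \<in> B"
    and add_mem: "x \<in> B \<Longrightarrow> y \<in> B \<Longrightarrow> x + y \<in> B"
    and mult_mem: "x \<in> B \<Longrightarrow> y \<in> B \<Longrightarrow> x * y \<in> B"
    and frobenius_fixed: "x \<in> B \<Longrightarrow> x ^ CARD('f) = x"
begin

lemma \<iota>_zero: "\<iota> 0 = 0"
  using \<iota>_add[of 0 0] by simp

lemma \<iota>_minus: "\<iota> (- c) = - \<iota> c"
  using \<iota>_add[of c "- c"] by (simp add: \<iota>_zero eq_neg_iff_add_eq_0 add.commute)

lemma diff_mem: "x \<in> B \<Longrightarrow> y \<in> B \<Longrightarrow> x - y \<in> B"
  using add_mem[of x "\<iota> (- 1) * y"] mult_mem[of "\<iota> (- 1)" y] \<iota>_mem[of "- 1"]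
  by (simp add: \<iota>_minus \<iota>_one)

lemma \<iota>_diff: "\<iota> (c - d) = \<iota> c - \<iota> d"
  using \<iota>_add[of c "- d"] by (simp add: \<iota>_minus)

lemma one_mem: "1 \<in> B"
  using \<iota>_mem[of 1] by (simp add: \<iota>_one)

lemma zero_mem: "0 \<in> B"
  using \<iota>_mem[of 0] by (simp add: \<iota>_zero)

lemma power_mem: "x \<in> B \<Longrightarrow> x ^ n \<in> B"
  by (induction n) (auto intro: one_mem mult_mem)

text \<open>This and the next three lemmas make substitution of \<open>x\<close> into polynomials
  over the field, with coefficients carried along \<open>\<iota>\<close>, compatible with sums,
  scalars and products. The factorisation of X^q - X can then be evaluated in the ring.\<close>

lemma eval_add:
  "poly (map_poly \<iota> (f + g)) x = poly (map_poly \<iota> f) x + poly (map_poly \<iota> g) x"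
  by (induction f g rule: poly_induct2) (simp_all add: map_poly_pCons \<iota>_zero \<iota>_add algebra_simps)

lemma eval_smult: "poly (map_poly \<iota> (smult c f)) x = \<iota> c * poly (map_poly \<iota> f) x"
  by (induction f) (simp_all add: map_poly_pCons \<iota>_zero \<iota>_mult algebra_simps)

lemma eval_mult:
  "poly (map_poly \<iota> (f * g)) x = poly (map_poly \<iota> f) x * poly (map_poly \<iota> g) x"
  by (induction f)
     (simp_all add: eval_add eval_smult map_poly_pCons \<iota>_zero algebra_simps)

lemma eval_prod:
  "poly (map_poly \<iota> (\<Prod>i\<in>I. f i)) x = (\<Prod>i\<in>I. poly (map_poly \<iota> (f i)) x)"
  by (induction I rule: infinite_finite_induct) (simp_all add: eval_mult \<iota>_one map_poly_1')

lemma prod_shift_eq_0: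
  assumes "x \<in> B"
  shows "(\<Prod>c\<in>UNIV. x - \<iota> c) = 0"
proof -
  have "(\<Prod>c\<in>UNIV. x - \<iota> c) = poly (map_poly \<iota> (\<Prod>c\<in>UNIV. [:- c, 1:])) x"
    by (simp add: eval_prod map_poly_pCons \<iota>_zero \<iota>_one \<iota>_minus)
  \<comment> \<open>The factorisation is read as "product plus X equals X^q", so additivity of the
    evaluation is enough.\<close>
  also have "\<dots> + poly (map_poly \<iota> [:0, 1:]) x = poly (map_poly \<iota> (Polynomial.monom 1 CARD('f))) x"
    by (subst eval_add[symmetric], subst prod_linear_factors_finite_field) simp
  also have "poly (map_poly \<iota> (Polynomial.monom 1 CARD('f))) x = x ^ CARD('f)"
    by (simp add: map_poly_monom \<iota>_zero \<iota>_one poly_monom)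
  finally show ?thesis
    by (simp add: map_poly_pCons \<iota>_zero \<iota>_one frobenius_fixed assms)
qed

text \<open>Suppose \<open>x\<close> in the corner is no scalar multiple of \<open>e\<close>. For
  each scalar c, \<open>e * (x - \<iota> c) ^ (q - 1)\<close> is an idempotent below
  \<open>e\<close>, and it is nonzero because its product with \<open>x - \<iota> c\<close> is
  \<open>x - \<iota> c * e\<close>. By primitivity it equals \<open>e\<close>. Multiplying over all
  c gives \<open>e = 0\<close>, since the product of the \<open>x - \<iota> c\<close> vanishes. So
  the corner is the line spanned by \<open>e\<close>.\<close>

lemma card_primitive_corner:
  assumes e: "e \<in> B" "e * e = e" "e \<noteq> 0"
    and prim: "\<And>f. f \<in> B \<Longrightarrow> f * f = f \<Longrightarrow> e * f = f \<Longrightarrow> f = 0 \<or> f = e"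
  shows "card {x \<in> B. e * x = x} = CARD('f)"
proof -
  have "\<exists>c. x = \<iota> c * e" if x: "x \<in> B" "e * x = x" for x
  proof (rule ccontr)
    assume no: "\<not> ?thesis"
    let ?q = "CARD('f)"
    have q: "?q = Suc (?q - 1)" by simp
    have inv: "e * (x - \<iota> c) ^ (?q - 1) = e" for c
    proof -
      let ?f = "e * (x - \<iota> c) ^ (?q - 1)"
      let ?y = "x - \<iota> c"
      have y: "?y \<in> B" by (intro diff_mem x \<iota>_mem)
      have yq: "?y ^ (?q - 1) * ?y = ?y"
        using frobenius_fixed[OF y] q by (metis power_Suc2)
      have fy: "?f * ?y = e * ?y" using yq by (simp add: mult.assoc)
      \<comment> \<open>With q \<ge> 2 one factor \<open>?y\<close> splits off
        \<open>?y ^ (?q - 1)\<close>; \<open>?f * ?y = e * ?y\<close> then shows that multiplying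
        \<open>?f\<close> by this power leaves it unchanged, whence \<open>?f\<close> is
        idempotent.\<close>
      have "2 \<le> ?q" using card_mono[of UNIV "{0, 1::'f}"] by simp
      then have q2: "?q - 1 = Suc (?q - 2)" by simp
      have "?f * ?y ^ (?q - 1) = (?f * ?y) * ?y ^ (?q - 2)"
        unfolding q2 by (simp only: power_Suc mult.assoc)
      also have "\<dots> = (e * ?y) * ?y ^ (?q - 2)" by (simp only: fy)
      also have "\<dots> = ?f" unfolding q2 by (simp only: power_Suc mult.assoc)
      finally have idem: "?f * ?y ^ (?q - 1) = ?f" .
      have ef: "e * ?f = ?f" using e by (simp only: mult.assoc[symmetric])
      have "?f * ?f = e * (?f * ?y ^ (?q - 1))" by (simp only: mult_ac)
      then have "?f * ?f = ?f" by (simp only: idem ef)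
      moreover have "?f \<in> B" by (intro mult_mem e power_mem y)
      moreover note ef
      ultimately have "?f = 0 \<or> ?f = e" by (intro prim)
      moreover have "?f \<noteq> 0"
      proof
        assume "?f = 0"
        then have "e * ?y = 0" using fy by simp
        then have "x = \<iota> c * e" using x by (simp add: algebra_simps)
        then show False using no by blast
      qed
      ultimately show ?thesis by blast
    qed
    have "e * (\<Prod>c\<in>C. (x - \<iota> c) ^ (?q - 1)) = e" for C
      by (induction C rule: infinite_finite_induct)
         (simp_all add: inv mult.assoc[symmetric] del: One_nat_def)
    \<comment> \<open>Here q - 1 > 0 matters: the zero product has to stay zero after raising it to
      the power q - 1.\<close>
    moreover have "(\<Prod>c\<in>UNIV. (x - \<iota> c) ^ (?q - 1)) = 0"
      using prod_shift_eq_0[OF x(1)] card_mono[of UNIV "{0, 1::'f}"]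
      by (simp add: prod_power_distrib[symmetric] power_0_left)
    ultimately show False using e by (metis mult_zero_right)
  qed
  then have "{x \<in> B. e * x = x} = range (\<lambda>c. \<iota> c * e)"
  proof safe
    fix c
    show "\<iota> c * e \<in> B" by (intro mult_mem \<iota>_mem e)
    have "e * (\<iota> c * e) = \<iota> c * (e * e)" by (simp only: mult_ac)
    then show "e * (\<iota> c * e) = \<iota> c * e" using e by simp
  qed blast
  moreover have "inj (\<lambda>c. \<iota> c * e)"
  proof (rule injI, rule ccontr)
    fix c d assume eq: "\<iota> c * e = \<iota> d * e" and "c \<noteq> d"
    then have "\<iota> (inverse (c - d)) * (\<iota> (c - d) * e) = e"
      by (simp add: mult.assoc[symmetric] \<iota>_mult[symmetric] \<iota>_one)
    moreover have "\<iota> (c - d) * e = 0"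
      using eq by (simp add: \<iota>_diff left_diff_distrib)
    ultimately show False using e by simp
  qed
  ultimately show ?thesis by (simp add: card_image)
qed

text \<open>Peirce decomposition \<open>x = f * x + (e - f) * x\<close>. It is applied both to the
  algebra and to its set of idempotents; the latter is not closed under addition in general, so only
  sums across the two orthogonal corners are required to stay in \<open>S\<close>.\<close>

lemma card_corner_split:
  fixes e f :: 'r
  assumes e: "e * e = e" and f: "f * f = f" "e * f = f"
    and S: "\<And>x. x \<in> S \<Longrightarrow> f * x \<in> S \<and> (e - f) * x \<in> S"
    and S': "\<And>x y. x \<in> S \<Longrightarrow> y \<in> S \<Longrightarrow> f * x = x \<Longrightarrow> (e - f) * y = y \<Longrightarrow> x + y \<in> S"
  shows "card {x \<in> S. e * x = x}
    = card {x \<in> S. f * x = x} * card {x \<in> S. (e - f) * x = x}"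
proof -
  let ?g = "e - f"
  have fg: "f * ?g = 0" "?g * f = 0" "?g * ?g = ?g" "e * ?g = ?g"
    using e f by (simp_all add: algebra_simps)
  \<comment> \<open>An element of the corner of \<open>h\<close> lies in that of \<open>e\<close>
    and is annihilated by any \<open>h'\<close> orthogonal to \<open>h\<close>.\<close>
  have below: "e * x = x" "h' * x = 0"
    if "h * x = x" "e * h = h" "h' * h = 0" for h h' x :: 'r
    using that by (metis mult.assoc mult_zero_left)+
  have "bij_betw (\<lambda>(x, y). x + y)
     ({x \<in> S. f * x = x} \<times> {x \<in> S. ?g * x = x}) {x \<in> S. e * x = x}"
  proof (rule bij_betw_byWitness[where f' = "\<lambda>x. (f * x, ?g * x)"])
    show "\<forall>z\<in>{x \<in> S. f * x = x} \<times> {x \<in> S. ?g * x = x}.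
        (f * (case z of (x, y) \<Rightarrow> x + y), ?g * (case z of (x, y) \<Rightarrow> x + y)) = z"
      using below[of f _ ?g] below[of ?g _ f] f fg
      by (auto simp: distrib_left)
    show "(\<lambda>(x, y). x + y) ` ({x \<in> S. f * x = x} \<times> {x \<in> S. ?g * x = x})
        \<subseteq> {x \<in> S. e * x = x}"
      using below(1)[of f _ ?g] below(1)[of ?g _ f] f fg S'
      by (auto simp: distrib_left)
    show "\<forall>x\<in>{x \<in> S. e * x = x}. (case (f * x, ?g * x) of (x, y) \<Rightarrow> x + y) = x"
      by (simp add: distrib_right[symmetric])
    show "(\<lambda>x. (f * x, ?g * x)) ` {x \<in> S. e * x = x}
        \<subseteq> {x \<in> S. f * x = x} \<times> {x \<in> S. ?g * x = x}"
      using S f(1) fg(3) by (simp add: image_subset_iff mult.assoc[symmetric])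
  qed
  then show ?thesis
    by (simp add: bij_betw_same_card[symmetric] card_cartesian_product)
qed

text \<open>Induction on the size of the corner, with one exponent for both counts: 0 if
  \<open>e = 0\<close>, 1 if \<open>e\<close> is primitive. Otherwise some \<open>f\<close> strictly
  below \<open>e\<close> splits the corner into two smaller ones; both counts multiply and the
  exponents add.\<close>

lemma card_corner:
  assumes "e \<in> B" "e * e = e"
  shows "\<exists>n. card {x \<in> B. e * x = x} = CARD('f) ^ n \<and>
     card {x \<in> {x \<in> B. x * x = x}. e * x = x} = 2 ^ n"
  using assms
proof (induction "card {x \<in> B. e * x = x}" arbitrary: e rule: less_induct)
  case less
  note e = less.prems
  let ?I = "{x \<in> B. x * x = x}"
  consider "e = 0" | "e \<noteq> 0" "\<And>f. f \<in> B \<Longrightarrow> f * f = f \<Longrightarrow> e * f = f \<Longrightarrow> f = 0 \<or> f = e"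
    | f where "f \<in> B" "f * f = f" "e * f = f" "f \<noteq> 0" "f \<noteq> e" by blast
  then show ?case
  proof cases
    case 1
    then have "{x \<in> B. e * x = x} = {0}" "{x \<in> ?I. e * x = x} = {0}" using zero_mem by auto
    then show ?thesis by (intro exI[of _ 0]) simp
  next
    case 2
    then have "{x \<in> ?I. e * x = x} = {0, e}" using e zero_mem by auto
    then have "card {x \<in> ?I. e * x = x} = 2" using 2(1) by simp
    moreover have "card {x \<in> B. e * x = x} = CARD('f)"
      using e 2 by (rule card_primitive_corner)
    ultimately show ?thesis by (metis power_one_right)
  next
    case 3
    let ?g = "e - f"
    have fg: "f * ?g = 0" "?g * ?g = ?g" "e * ?g = ?g"
      using e(2) 3(2,3) by (simp_all add: algebra_simps)
    have gB: "?g \<in> B" by (intro diff_mem e 3)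
    have sub: "{x \<in> B. h * x = x} \<subset> {x \<in> B. e * x = x}"
      if h: "h \<in> B" "e * h = h" "h \<noteq> e" for h
    proof -
      have "{x \<in> B. h * x = x} \<subseteq> {x \<in> B. e * x = x}"
      proof safe
        fix x assume "h * x = x"
        then have "e * x = e * (h * x)" by simp
        also have "\<dots> = h * x" using h by (simp only: mult.assoc[symmetric])
        finally show "e * x = x" using \<open>h * x = x\<close> by simp
      qed
      \<comment> \<open>Strictness: \<open>h * e = e\<close> together with \<open>e * h = h\<close>
        would give \<open>h = e\<close>.\<close>
      moreover have "e \<notin> {x \<in> B. h * x = x}" using h by (auto simp: mult.commute)
      ultimately show ?thesis using e by blast
    qed
    have "f \<in> B" "?g \<noteq> e" using 3 by auto
    then obtain m n where mn:
      "card {x \<in> B. f * x = x} = CARD('f) ^ m" "card {x \<in> ?I. f * x = x} = 2 ^ m"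
      "card {x \<in> B. ?g * x = x} = CARD('f) ^ n" "card {x \<in> ?I. ?g * x = x} = 2 ^ n"
      using less.hyps[OF psubset_card_mono[OF finite_subset[OF _ finite_B] sub[OF 3(1,3,5)]] 3(1,2)]
        less.hyps[OF psubset_card_mono[OF finite_subset[OF _ finite_B] sub[OF gB fg(3)]] gB fg(2)] by auto
    have "card {x \<in> B. e * x = x} = card {x \<in> B. f * x = x} * card {x \<in> B. ?g * x = x}"
      using 3 gB e by (intro card_corner_split) (auto intro: mult_mem add_mem)
    moreover have "card {x \<in> ?I. e * x = x} = card {x \<in> ?I. f * x = x} * card {x \<in> ?I. ?g * x = x}"
    proof (rule card_corner_split)
      have "h * x \<in> ?I" if "h \<in> B" "h * h = h" "x \<in> ?I" for h x
      proof -
        have "(h * x) * (h * x) = (h * h) * (x * x)" by (simp only: mult_ac)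
        then show ?thesis using that by (simp add: mult_mem)
      qed
      then show "f * x \<in> ?I \<and> ?g * x \<in> ?I" if "x \<in> ?I" for x
        using that 3(1,2) gB fg(2) by blast
    next
      fix x y assume x: "x \<in> ?I" "f * x = x" and y: "y \<in> ?I" "?g * y = y"
      have "(f * x) * (?g * y) = (f * ?g) * (x * y)" by (simp only: mult_ac)
      then have "x * y = (f * ?g) * (x * y)" using x y by simp
      then have "x * y = 0" using fg by simp
      then show "x + y \<in> ?I" using x y by (auto simp: algebra_simps intro: add_mem)
    qed (use 3 e in auto)
    ultimately show ?thesis
      using mn by (intro exI[of _ "m + n"]) (simp add: power_add)
  qed
qed

text \<open>The corner of 1 is all of \<open>B\<close>, and q \<ge> 2 makes the exponent of a power
  of q unique.\<close>

theorem card_idempotents: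
  assumes "card B = CARD('f) ^ n"
  shows "card {x \<in> B. x * x = x} = 2 ^ n"
proof -
  have "2 \<le> CARD('f)" using card_mono[of UNIV "{0, 1::'f}"] by simp
  moreover obtain m where "card B = CARD('f) ^ m" "card {x \<in> B. x * x = x} = 2 ^ m"
    using card_corner[OF one_mem] by auto
  ultimately show ?thesis using assms by simp
qed

end

section \<open>Lagrange's theorem in additive form and the order of q modulo the group order\<close>

section \<open>Multiples in finite abelian groups\<close>

lemma nat_mult_0 [simp]: "nat_mult 0 a = 0"
  and nat_mult_Suc: "nat_mult (Suc n) a = nat_mult n a + a"
  by (simp_all add: nat_mult_def)

lemma nat_mult_1 [simp]: "nat_mult (Suc 0) a = a"
  by (simp add: nat_mult_Suc)

lemma nat_mult_zero [simp]: "nat_mult n 0 = 0"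
  by (simp add: nat_mult_def)

lemma nat_mult_uminus: "nat_mult n (- a) = - nat_mult n a"
  by (simp add: nat_mult_def sum_negf)

lemma nat_mult_add_left: "nat_mult (m + n) a = nat_mult m a + nat_mult n a"
  by (induction n) (simp_all add: nat_mult_Suc add.assoc)

lemma nat_mult_mult: "nat_mult (m * n) a = nat_mult m (nat_mult n a)"
  by (induction m) (simp_all add: nat_mult_Suc nat_mult_add_left add.commute)

lemma nat_mult_Pair: "nat_mult n (a, b) = (nat_mult n a, nat_mult n b)"
  by (induction n) (simp_all add: nat_mult_Suc zero_prod_def)

lemma nat_mult_of_nat: "nat_mult n (1 :: 'r::ring_1) = of_nat n"
  by (induction n) (simp_all add: nat_mult_Suc add.commute)

text \<open>Translation by \<open>a\<close> permutes the group and so preserves the sum of all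
  elements; comparing the two sums leaves the multiple of \<open>a\<close> by the group
  order.\<close>

lemma nat_mult_card: "nat_mult CARD('a) (a :: 'a::{ab_group_add, finite}) = 0"
proof -
  have "(\<Sum>x\<in>UNIV. x + a) = (\<Sum>x\<in>UNIV. x :: 'a)"
    by (rule sum.reindex_bij_witness[of _ "\<lambda>x. x - a" "\<lambda>x. x + a"]) auto
  then have sum0: "(\<Sum>x\<in>(UNIV :: 'a set). a) = 0"
    by (simp add: sum.distrib)
  obtain h where "bij_betw h {..<CARD('a)} (UNIV :: 'a set)"
    using ex_bij_betw_nat_finite[of "UNIV :: 'a set"] by (auto simp: atLeast0LessThan)
  then have "(\<Sum>j<CARD('a). a) = (\<Sum>x\<in>(UNIV :: 'a set). a)"
    by (rule sum.reindex_bij_betw)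
  then show ?thesis
    using sum0 by (simp add: nat_mult_def)
qed

lemma nat_mult_card_dvd:
  fixes a :: "'a::{ab_group_add, finite}"
  assumes "CARD('a) dvd n"
  shows "nat_mult n a = 0"
proof -
  from assms obtain k where "n = k * CARD('a)" by (metis dvdE mult.commute)
  then show ?thesis by (simp add: nat_mult_mult nat_mult_card)
qed

text \<open>By pigeonhole two powers of \<open>q\<close> agree modulo \<open>n\<close>; the smaller
  one is coprime to \<open>n\<close> and cancels.\<close>

lemma ex_power_cong_1:
  fixes q n :: nat
  assumes "coprime q n" "n > 0" "q > 0"
  shows "\<exists>N>0. n dvd q ^ N - 1"
proof -
  have "\<not> inj (\<lambda>i. q ^ i mod n)"
  proof
    assume "inj (\<lambda>i. q ^ i mod n)"
    moreover have "range (\<lambda>i. q ^ i mod n) \<subseteq> {..<n}" using assms by auto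
    ultimately show False
      using finite_imageD[of "\<lambda>i. q ^ i mod n" UNIV] finite_subset[of _ "{..<n}"] by simp
  qed
  then obtain i j where "q ^ i mod n = q ^ j mod n" "i < j"
    unfolding inj_def by (metis linorder_neqE_nat)
  then have "n dvd q ^ j - q ^ i" "j = i + (j - i)"
    using mod_eq_dvd_iff_nat[of "q ^ i" "q ^ j" n] assms by (simp_all add: power_increasing)
  then have "n dvd q ^ i * (q ^ (j - i) - 1)"
    by (metis diff_mult_distrib2 mult.right_neutral power_add)
  then have "n dvd q ^ (j - i) - 1"
    using assms by (simp add: coprime_dvd_mult_right_iff coprime_commute)
  then show ?thesis using \<open>i < j\<close> by (intro exI[of _ "j - i"]) simp
qed

text \<open>Choose \<open>N\<close> with \<open>q ^ N\<close> congruent to 1 modulo the group order.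
  Multiplication by \<open>q\<close> is thus a permutation, which is what makes cyclotomic classes
  into orbits.\<close>

lemma ex_power_nat_mult_id:
  assumes "coprime q CARD('a::{ab_group_add, finite})" "q > 0"
  shows "\<exists>N>0. \<forall>a :: 'a. nat_mult (q ^ N) a = a"
proof -
  obtain N where N: "N > 0" "CARD('a) dvd q ^ N - 1"
    using ex_power_cong_1[OF assms(1)] assms by auto
  have "nat_mult (q ^ N) a = a" for a :: 'a
  proof -
    have "q ^ N = q ^ N - 1 + 1" using assms by simp
    then show ?thesis
      using nat_mult_card_dvd[OF N(2), of a]
      by (metis One_nat_def add_0 nat_mult_1 nat_mult_add_left)
  qed
  then show ?thesis using N by blast
qed

text \<open>The order of the additive group annihilates 1, so the characteristic, a prime, divides a
  power of \<open>p\<close>.\<close>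

lemma CHAR_finite_field:
  assumes "prime p" "CARD('f::{field, finite}) = p ^ k"
  shows "CHAR('f) = p"
proof -
  have "of_nat CARD('f) = (0 :: 'f)"
    using nat_mult_card[of "1 :: 'f"] by (simp add: nat_mult_of_nat)
  then have "CHAR('f) dvd p ^ k"
    unfolding of_nat_eq_0_iff_char_dvd assms(2) .
  moreover have "prime CHAR('f)"
    by (intro prime_CHAR_semidom finite_imp_CHAR_pos) simp
  ultimately show ?thesis
    using assms by (metis prime_dvd_power primes_dvd_imp_eq)
qed

section \<open>Convolution, characteristic and powers in F[G]\<close>

section \<open>Group algebras of finite abelian groups\<close>

lemma poly_mapping_eq_sum_single:
  fixes u :: "('f::{field, finite}, 'g::{ab_group_add, finite}) group_algebra"
  shows "u = (\<Sum>g\<in>UNIV. Poly_Mapping.single g (Poly_Mapping.lookup u g))"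
  by (rule poly_mapping_eqI) (simp add: lookup_sum lookup_single when_def)

lemma finite_group_algebra:
  fixes V :: "('f::{field, finite}, 'g::{ab_group_add, finite}) group_algebra set"
  shows "finite V"
proof -
  have "inj_on Poly_Mapping.lookup V"
    by (rule inj_onI) (rule poly_mapping_eqI, simp)
  then show ?thesis by (rule inj_on_finite[of _ _ UNIV]) auto
qed

lemma lookup_single_mult:
  fixes u :: "('f::{field, finite}, 'g::{ab_group_add, finite}) group_algebra"
  shows "Poly_Mapping.lookup (Poly_Mapping.single h c * u) g = c * Poly_Mapping.lookup u (g - h)"
proof -
  have "Poly_Mapping.single h c * u
      = (\<Sum>k\<in>UNIV. Poly_Mapping.single (h + k) (c * Poly_Mapping.lookup u k))"
    by (subst poly_mapping_eq_sum_single[of u]) (simp add: sum_distrib_left mult_single)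
  then have "Poly_Mapping.lookup (Poly_Mapping.single h c * u) g
      = (\<Sum>k\<in>UNIV. if k = g - h then c * Poly_Mapping.lookup u k else 0)"
    by (auto simp: lookup_sum lookup_single when_def algebra_simps intro!: sum.cong)
  then show ?thesis by simp
qed

lemma lookup_mult_finite:
  fixes u v :: "('f::{field, finite}, 'g::{ab_group_add, finite}) group_algebra"
  shows "Poly_Mapping.lookup (u * v) k = (\<Sum>g\<in>UNIV. Poly_Mapping.lookup u g * Poly_Mapping.lookup v (k - g))"
proof -
  have "u * v = (\<Sum>g\<in>UNIV. Poly_Mapping.single g (Poly_Mapping.lookup u g) * v)"
    by (subst poly_mapping_eq_sum_single[of u]) (simp add: sum_distrib_right)
  then show ?thesis by (simp add: lookup_sum lookup_single_mult)
qed

lemma single_power: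
  "Poly_Mapping.single g (c :: 'f::{field, finite}) ^ n
    = Poly_Mapping.single (nat_mult n (g :: 'g::{ab_group_add, finite})) (c ^ n)"
  by (induction n) (simp_all add: mult_single nat_mult_Suc add.commute)

lemma CHAR_group_algebra:
  "CHAR(('f::{field, finite}, 'g::{ab_group_add, finite}) group_algebra) = CHAR('f)"
proof (rule CHAR_eqI)
  show "of_nat CHAR('f) = (0 :: ('f, 'g) group_algebra)"
    by (simp flip: single_of_nat)
  fix n assume "of_nat n = (0 :: ('f, 'g) group_algebra)"
  then have "Poly_Mapping.lookup (of_nat n :: ('f, 'g) group_algebra) 0 = 0" by simp
  then show "CHAR('f) dvd n"
    by (simp add: lookup_of_nat of_nat_eq_0_iff_char_dvd)
qed

text \<open>The Frobenius map is additive, so it acts term by term on the sum of the u_g Y^g. The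
  coefficient at \<open>h\<close> is a sum because multiplication by \<open>p ^ n\<close> need not
  be injective on the group.\<close>

lemma lookup_power_char:
  fixes u :: "('f::{field, finite}, 'g::{ab_group_add, finite}) group_algebra"
  assumes "prime p" "CHAR('f) = p"
  shows "Poly_Mapping.lookup (u ^ (p ^ n)) h = (\<Sum>g | nat_mult (p ^ n) g = h. Poly_Mapping.lookup u g ^ (p ^ n))"
proof -
  have "u ^ (p ^ n) = (\<Sum>g\<in>UNIV. Poly_Mapping.single g (Poly_Mapping.lookup u g)) ^ (p ^ n)"
    using poly_mapping_eq_sum_single[of u] by simp
  also have "\<dots> = (\<Sum>g\<in>UNIV. Poly_Mapping.single (nat_mult (p ^ n) g) (Poly_Mapping.lookup u g ^ (p ^ n)))"
    by (subst freshmans_dream_sum') (simp_all add: CHAR_group_algebra assms single_power)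
  finally show ?thesis
    by (simp add: lookup_sum lookup_single when_def sum.If_cases Collect_conj_eq)
qed

section \<open>The involution Y^g |-> Y^(-g) and its relation to the Euclidean form\<close>

definition conj_ga ::
    "('f::{field, finite}, 'g::{ab_group_add, finite}) group_algebra \<Rightarrow> ('f, 'g) group_algebra" where
  "conj_ga u = Abs_poly_mapping (\<lambda>g. Poly_Mapping.lookup u (- g))"

lemma lookup_conj_ga [simp]: "Poly_Mapping.lookup (conj_ga u) g = Poly_Mapping.lookup u (- g)"
  by (simp add: conj_ga_def)

lemma conj_ga_conj_ga [simp]: "conj_ga (conj_ga u) = u"
  by (rule poly_mapping_eqI) simp

lemma conj_ga_add: "conj_ga (u + v) = conj_ga u + conj_ga v"
  by (rule poly_mapping_eqI) (simp add: lookup_add)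

lemma conj_ga_diff: "conj_ga (u - v) = conj_ga u - conj_ga v"
  by (rule poly_mapping_eqI) (simp add: lookup_minus)

lemma conj_ga_single: "conj_ga (Poly_Mapping.single g c) = Poly_Mapping.single (- g) c"
  by (rule poly_mapping_eqI) (auto simp: lookup_single when_def)

lemma conj_ga_0 [simp]: "conj_ga 0 = 0"
  by (rule poly_mapping_eqI) simp

lemma conj_ga_1 [simp]: "conj_ga 1 = 1"
  using conj_ga_single[of 0 1] by simp

lemma conj_ga_mult: "conj_ga (u * v) = conj_ga u * conj_ga v"
proof (rule poly_mapping_eqI)
  fix k
  show "Poly_Mapping.lookup (conj_ga (u * v)) k = Poly_Mapping.lookup (conj_ga u * conj_ga v) k"
    unfolding lookup_conj_ga lookup_mult_finite
    by (rule sum.reindex_bij_witness[of _ uminus uminus]) auto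
qed

text \<open>At 0 the convolution pairs g with -g, and conjugating the second factor turns -g back
  into g.\<close>

lemma euclidean_inner_eq_lookup: "euclidean_inner u v = Poly_Mapping.lookup (u * conj_ga v) 0"
  by (simp add: euclidean_inner_def lookup_mult_finite)

lemma euclidean_inner_commute: "euclidean_inner u v = euclidean_inner v u"
  by (simp add: euclidean_inner_def mult.commute)

lemma euclidean_inner_diff_right:
  "euclidean_inner u (v - w) = euclidean_inner u v - euclidean_inner u w"
  by (simp add: euclidean_inner_eq_lookup conj_ga_diff right_diff_distrib lookup_minus)

lemma euclidean_inner_scale_right:
  "euclidean_inner u (Poly_Mapping.single 0 c * v) = c * euclidean_inner u v"
  by (simp add: euclidean_inner_def lookup_single_mult sum_distrib_left mult.left_commute)

section \<open>Nondegeneracy of the form and the idempotent generators of codes\<close>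

section \<open>Complementary dual codes and self-conjugate idempotents\<close>

text \<open>Nondegeneracy, by induction on a finite spanning set. For a new generator
  \<open>b\<close> outside the span, correct a vector \<open>v2\<close> by a multiple of a vector
  \<open>v1\<close> that vanishes on the old span but not at \<open>b\<close>.\<close>

lemma ex_separating_dual_vector:
  fixes V :: "('f::{field, finite}, 'g::{ab_group_add, finite}) group_algebra set"
  assumes V: "0 \<in> V" "\<And>u v. u \<in> V \<Longrightarrow> v \<in> V \<Longrightarrow> u + v \<in> V"
      "\<And>c u. u \<in> V \<Longrightarrow> Poly_Mapping.single 0 c * u \<in> V"
    and w: "w \<notin> V"
  shows "\<exists>v\<in>euclidean_dual V. euclidean_inner v w \<noteq> 0"
proof -
  interpret vector_space "\<lambda>c (u :: ('f, 'g) group_algebra). Poly_Mapping.single 0 c * u"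
    by standard (simp_all add: algebra_simps single_add mult_single flip: mult.assoc)
  have sep: "\<exists>v. (\<forall>x\<in>span S. euclidean_inner v x = 0) \<and> euclidean_inner v w \<noteq> 0"
    if "finite S" "w \<notin> span S" for S w
    using that
  proof (induction S arbitrary: w rule: finite_induct)
    case empty
    then obtain g where g: "Poly_Mapping.lookup w g \<noteq> 0"
      using poly_mapping_eqI[of w 0] by auto
    have "euclidean_inner (Poly_Mapping.single g 1) w = Poly_Mapping.lookup w g"
      by (simp add: euclidean_inner_eq_lookup lookup_single_mult)
    then show ?case
      using g by (intro exI[of _ "Poly_Mapping.single g 1"]) (simp add: euclidean_inner_eq_lookup)
  next
    case (insert b S)
    show ?case
    proof (cases "b \<in> span S")
      case True
      then have "span (insert b S) = span S" by (rule span_redundant)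
      then show ?thesis using insert by simp
    next
      case False
      then obtain v1 where v1: "\<And>x. x \<in> span S \<Longrightarrow> euclidean_inner v1 x = 0"
        "euclidean_inner v1 b \<noteq> 0" using insert.IH by blast
      \<comment> \<open>This makes \<open>v1\<close> orthogonal to \<open>w - k b\<close>, so the
        later correction by \<open>v1\<close> does not spoil the separation.\<close>
      define k where "k = euclidean_inner v1 w / euclidean_inner v1 b"
      have "w - Poly_Mapping.single 0 k * b \<notin> span S"
        using insert.prems by (auto simp: span_breakdown_eq)
      then obtain v2 where v2: "\<And>x. x \<in> span S \<Longrightarrow> euclidean_inner v2 x = 0"
        "euclidean_inner v2 (w - Poly_Mapping.single 0 k * b) \<noteq> 0" using insert.IH by blast
      \<comment> \<open>Chosen so that \<open>v\<close> is orthogonal to \<open>b\<close>; the value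
        of \<open>v\<close> at \<open>w\<close> is then that of \<open>v2\<close> at
        \<open>w - k b\<close>.\<close>
      define l where "l = euclidean_inner v2 b / euclidean_inner v1 b"
      define v where "v = v2 - Poly_Mapping.single 0 l * v1"
      have v: "euclidean_inner v x = euclidean_inner v2 x - l * euclidean_inner v1 x" for x
        unfolding v_def euclidean_inner_commute[of _ x]
        by (simp add: euclidean_inner_diff_right euclidean_inner_scale_right)
      have b: "euclidean_inner v b = 0" using v1(2) by (simp add: v l_def)
      have "euclidean_inner v x = 0" if "x \<in> span (insert b S)" for x
      proof -
        obtain c where "x - Poly_Mapping.single 0 c * b \<in> span S"
          using \<open>x \<in> span (insert b S)\<close> by (auto simp: span_breakdown_eq)
        then have "euclidean_inner v (x - Poly_Mapping.single 0 c * b) = 0"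
          using v1(1) v2(1) by (simp add: v)
        then show ?thesis using b by (simp add: euclidean_inner_diff_right euclidean_inner_scale_right)
      qed
      moreover have "euclidean_inner v w \<noteq> 0"
        using v2(2) v1(2)
        by (simp add: v l_def k_def euclidean_inner_diff_right euclidean_inner_scale_right
            mult.commute[of "euclidean_inner v2 b"])
      ultimately show ?thesis by blast
    qed
  qed
  have "subspace V" using V by (simp add: subspace_def)
  then have span: "span V = V" by (rule span_eq_iff[THEN iffD2])
  \<comment> \<open>Being finite, \<open>V\<close> serves as its own spanning set.\<close>
  have "finite V" by (rule finite_group_algebra)
  then show ?thesis
    using sep[of V w] w unfolding span euclidean_dual_def by (auto simp: euclidean_inner_commute)
qed

lemma euclidean_dual_antimono: "C \<subseteq> D \<Longrightarrow> euclidean_dual D \<subseteq> euclidean_dual C"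
  by (auto simp: euclidean_dual_def)

text \<open>An ideal contains Y^(-k) c along with c, and multiplying by Y^(-k) moves the coefficient
  at k to 0. Orthogonality to the whole ideal thus forces every coefficient of
  \<open>c * conj_ga v\<close> to vanish.\<close>

lemma mem_euclidean_dual_iff:
  assumes "abelian_code C"
  shows "v \<in> euclidean_dual C \<longleftrightarrow> (\<forall>c\<in>C. c * conj_ga v = 0)"
proof
  assume v: "v \<in> euclidean_dual C"
  show "\<forall>c\<in>C. c * conj_ga v = 0"
  proof (intro ballI poly_mapping_eqI)
    fix c k assume "c \<in> C"
    then have "Poly_Mapping.single (- k) 1 * c \<in> C"
      using assms by (simp add: abelian_code_iff)
    then have "euclidean_inner (Poly_Mapping.single (- k) 1 * c) v = 0"
      using v by (simp add: euclidean_dual_def)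
    then show "Poly_Mapping.lookup (c * conj_ga v) k = Poly_Mapping.lookup 0 k"
      by (simp add: euclidean_inner_eq_lookup mult.assoc lookup_single_mult)
  qed
qed (auto simp: euclidean_dual_def euclidean_inner_eq_lookup)

lemma abelian_code_euclidean_dual:
  fixes C :: "('f::{field, finite}, 'g::{ab_group_add, finite}) group_algebra set"
  assumes "abelian_code C"
  shows "abelian_code (euclidean_dual C)"
proof -
  have "c * conj_ga (r * u) = conj_ga r * (c * conj_ga u)" for c r u :: "('f, 'g) group_algebra"
    by (simp only: conj_ga_mult mult.left_commute)
  then show ?thesis
    by (simp add: abelian_code_iff mem_euclidean_dual_iff[OF assms] conj_ga_add distrib_left)
qed

lemma euclidean_dual_dual_subset:
  assumes "abelian_code C"
  shows "euclidean_dual (euclidean_dual C) \<subseteq> C"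
proof
  fix w assume w: "w \<in> euclidean_dual (euclidean_dual C)"
  show "w \<in> C"
  proof (rule ccontr)
    assume "w \<notin> C"
    then have "\<exists>v\<in>euclidean_dual C. euclidean_inner v w \<noteq> 0"
      using assms by (intro ex_separating_dual_vector) (auto simp: abelian_code_iff)
    then show False using w by (auto simp: euclidean_dual_def)
  qed
qed

text \<open>If 1 were outside the sum of \<open>C\<close> and its dual, some \<open>v\<close>
  orthogonal to that sum would have nonzero product with 1. Such a \<open>v\<close> lies in the dual
  and in the double dual, hence in \<open>C\<close>, so it is 0.\<close>

lemma complementary_dual_decomposes_1:
  fixes C :: "('f::{field, finite}, 'g::{ab_group_add, finite}) group_algebra set"
  assumes C: "abelian_code C" and cd: "euclidean_complementary_dual C"
  shows "\<exists>e\<in>C. 1 - e \<in> euclidean_dual C"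
proof (rule ccontr)
  let ?D = "euclidean_dual C"
  let ?S = "{c + d | c d. c \<in> C \<and> d \<in> ?D}"
  note D = abelian_code_euclidean_dual[OF C]
  have zero: "0 \<in> C" "0 \<in> ?D" using C D by (simp_all add: abelian_code_iff)
  assume "\<not> (\<exists>e\<in>C. 1 - e \<in> ?D)"
  then have "1 \<notin> ?S" by clarsimp (metis add_diff_cancel_left')
  moreover have "0 \<in> ?S" using zero by force
  moreover have "u + v \<in> ?S" if uv: "u \<in> ?S" "v \<in> ?S" for u v
  proof -
    obtain c d c' d' where "u = c + d" "v = c' + d'" "c \<in> C" "c' \<in> C" "d \<in> ?D" "d' \<in> ?D"
      using uv by blast
    moreover have "u + v = (c + c') + (d + d')" using calculation by (simp add: ac_simps)
    moreover have "c + c' \<in> C" "d + d' \<in> ?D"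
      using calculation C D by (simp_all add: abelian_code_iff)
    ultimately show ?thesis by blast
  qed
  moreover have "r * u \<in> ?S" if u: "u \<in> ?S" for r u
  proof -
    obtain c d where "u = c + d" "c \<in> C" "d \<in> ?D" using u by blast
    moreover have "r * c \<in> C" "r * d \<in> ?D"
      using calculation C D by (simp_all add: abelian_code_iff)
    ultimately show ?thesis by (auto simp: distrib_left)
  qed
  ultimately obtain v where v: "v \<in> euclidean_dual ?S" "euclidean_inner v 1 \<noteq> 0"
    using ex_separating_dual_vector[of ?S 1] by blast
  have "C \<subseteq> ?S" "?D \<subseteq> ?S" using zero by force+
  then have "v \<in> ?D" "v \<in> euclidean_dual ?D"
    using v(1) euclidean_dual_antimono[of _ ?S] by blast+
  then have "v = 0"
    using euclidean_dual_dual_subset[OF C] cd by (auto simp: euclidean_complementary_dual_def)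
  then show False using v(2) by (simp add: euclidean_inner_eq_lookup)
qed

lemma complementary_dual_iff_idempotent:
  fixes C :: "('f::{field, finite}, 'g::{ab_group_add, finite}) group_algebra set"
  shows "abelian_code C \<and> euclidean_complementary_dual C \<longleftrightarrow>
    (\<exists>e. e * e = e \<and> conj_ga e = e \<and> C = {u. e * u = u})"
proof safe
  assume C: "abelian_code C" and cd: "euclidean_complementary_dual C"
  let ?D = "euclidean_dual C"
  obtain e where e: "e \<in> C" "1 - e \<in> ?D"
    using complementary_dual_decomposes_1[OF C cd] by blast
  have meet: "u = 0" if "u \<in> C" "u \<in> ?D" for u
    using cd that by (auto simp: euclidean_complementary_dual_def)
  have mem: "r * u \<in> C" "r * v \<in> ?D" if "u \<in> C" "v \<in> ?D" for r u v
    using that C abelian_code_euclidean_dual[OF C] by (simp_all add: abelian_code_iff)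
  \<comment> \<open>The product \<open>c * (1 - e)\<close> lies in both \<open>C\<close> and its
    dual.\<close>
  have fix_C: "e * c = c" if "c \<in> C" for c
    using meet[of "c * (1 - e)"] mem(2)[OF that e(2), of c] mem(1)[OF that e(2), of "1 - e"]
    by (simp add: algebra_simps)
  \<comment> \<open>This gives \<open>e = e * conj_ga e\<close>, whose right-hand side is visibly
    fixed by conjugation.\<close>
  have "e * conj_ga (1 - e) = 0"
    using e C mem_euclidean_dual_iff by blast
  then have ee: "e * conj_ga e = e"
    by (simp add: conj_ga_diff right_diff_distrib)
  have "conj_ga e = conj_ga (e * conj_ga e)" by (simp only: ee)
  also have "\<dots> = e"
    by (subst conj_ga_mult) (simp only: conj_ga_conj_ga mult.commute[of "conj_ga e" e] ee)
  finally have "conj_ga e = e" .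
  moreover have "u \<in> C" if "e * u = u" for u
    using mem(1)[OF e, of u] that by (simp add: mult.commute)
  ultimately show "\<exists>e. e * e = e \<and> conj_ga e = e \<and> C = {u. e * u = u}"
    using fix_C e(1) by blast
next
  fix e :: "('f, 'g) group_algebra"
  assume e: "e * e = e" "conj_ga e = e"
  let ?C = "{u. e * u = u}"
  show C: "abelian_code ?C"
    by (auto simp: abelian_code_iff distrib_left mult.left_commute)
  have "v = 0" if v: "e * v = v" "v \<in> euclidean_dual ?C" for v
  proof -
    \<comment> \<open>As \<open>e\<close> belongs to the code, it annihilates
      \<open>conj_ga v\<close>; since \<open>e\<close> is self-conjugate, conjugation turns this
      into \<open>e * v = 0\<close>.\<close>
    have "e * conj_ga v = 0"
      using v(2) e(1) by (auto simp: mem_euclidean_dual_iff[OF C])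
    then have "conj_ga (e * v) = 0" by (simp add: conj_ga_mult e(2))
    then have "conj_ga (conj_ga v) = 0" using v(1) by simp
    then show ?thesis by simp
  qed
  moreover have "0 \<in> euclidean_dual ?C" by (simp add: mem_euclidean_dual_iff[OF C])
  ultimately show "euclidean_complementary_dual ?C"
    by (auto simp: euclidean_complementary_dual_def)
qed

text \<open>The generating idempotent is the identity element of its ideal and is therefore
  determined by it.\<close>

lemma card_complementary_dual_codes:
  "card {C :: ('f::{field, finite}, 'g::{ab_group_add, finite}) group_algebra set.
      abelian_code C \<and> euclidean_complementary_dual C}
    = card {e :: ('f, 'g) group_algebra. e * e = e \<and> conj_ga e = e}"
proof -
  let ?h = "\<lambda>e :: ('f, 'g) group_algebra. {u. e * u = u}"
  have "inj_on ?h {e. e * e = e \<and> conj_ga e = e}"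
  proof (rule inj_onI)
    fix d e assume "d \<in> {e. e * e = e \<and> conj_ga e = e}" "e \<in> {e. e * e = e \<and> conj_ga e = e}"
      and eq: "?h d = ?h e"
    then have "d \<in> ?h e" "e \<in> ?h d" by auto
    then show "d = e" by (simp add: mult.commute)
  qed
  moreover have "{C. abelian_code C \<and> euclidean_complementary_dual C}
      = ?h ` {e. e * e = e \<and> conj_ga e = e}"
    unfolding complementary_dual_iff_idempotent by blast
  ultimately show ?thesis by (simp add: card_image)
qed


section \<open>Orbits of multiplication by q, with and without negation\<close>

section \<open>Cyclotomic classes\<close>

lemma cyclotomic_class_self: "a \<in> cyclotomic_class q a"
  unfolding cyclotomic_class_def by (rule CollectI, rule exI[of _ 0]) simp

lemma cyclotomic_class_mult_mem: "nat_mult q a \<in> cyclotomic_class q a"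
  unfolding cyclotomic_class_def by (rule CollectI, rule exI[of _ 1]) simp

lemma cyclotomic_class_uminus: "cyclotomic_class q (- a) = uminus ` cyclotomic_class q a"
  by (auto simp: cyclotomic_class_def nat_mult_uminus)

text \<open>Some power of \<open>q\<close> acts as the identity, so \<open>a\<close> is also a
  multiple of \<open>b\<close> by a power of \<open>q\<close>.\<close>

lemma cyclotomic_class_eq:
  fixes a b :: "'a::{ab_group_add, finite}"
  assumes q: "coprime q CARD('a)" "q > 0" and b: "b \<in> cyclotomic_class q a"
  shows "cyclotomic_class q b = cyclotomic_class q a"
proof -
  have trans: "cyclotomic_class q y \<subseteq> cyclotomic_class q x"
    if "y \<in> cyclotomic_class q x" for x y :: 'a
    using that unfolding cyclotomic_class_def
    by (auto simp flip: nat_mult_mult power_add)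
  obtain N where N: "N > 0" "\<And>a :: 'a. nat_mult (q ^ N) a = a"
    using ex_power_nat_mult_id[OF q] by blast
  obtain i where i: "b = nat_mult (q ^ i) a"
    using b by (auto simp: cyclotomic_class_def)
  have "nat_mult (q ^ (N * i)) x = x" for x :: 'a
    by (induction i) (simp_all add: power_add nat_mult_mult N)
  \<comment> \<open>The exponents \<open>(N - 1) * i\<close> and \<open>i\<close> add up to
    \<open>N * i\<close>, which acts trivially.\<close>
  then have "nat_mult (q ^ ((N - 1) * i)) b = a"
    using N(1) by (simp add: i flip: nat_mult_mult power_add)
      (metis One_nat_def Suc_pred add.commute mult_Suc)
  then have "a \<in> cyclotomic_class q b"
    by (auto simp: cyclotomic_class_def)
  then show ?thesis using trans b by blast
qed

text \<open>For \<open>q\<close> coprime to the order of the group this is the orbit of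
  \<open>a\<close> under multiplication by \<open>q\<close> and negation.\<close>

abbreviation sym_class :: "nat \<Rightarrow> 'a::ab_group_add \<Rightarrow> 'a set" where
  "sym_class q a \<equiv> cyclotomic_class q a \<union> cyclotomic_class q (- a)"

text \<open>The map \<open>h\<close> sending a class to its union with its negative is the identity
  on type I and two-to-one on type II, and the two images are disjoint.\<close>

lemma card_sym_classes:
  assumes q: "coprime q CARD('a::{ab_group_add, finite})" "q > 0"
    and I: "card (type_I_classes q :: 'a set set) = m"
    and II: "card (type_II_classes q :: 'a set set) = 2 * n"
  shows "card (range (sym_class q :: 'a \<Rightarrow> 'a set)) = m + n"
proof -
  let ?I = "type_I_classes q :: 'a set set" and ?II = "type_II_classes q :: 'a set set"
  let ?S = "cyclotomic_class q :: 'a \<Rightarrow> 'a set"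
  define h where "h = (\<lambda>T :: 'a set. T \<union> uminus ` T)"
  have S_neg: "uminus ` ?S a = ?S (- a)" for a by (simp add: cyclotomic_class_uminus)
  have h_S: "h (?S a) = sym_class q a" for a by (simp add: h_def S_neg)
  have h_eq: "?S b = ?S a \<or> ?S b = ?S (- a)" if "h (?S a) = h (?S b)" for a b
  proof -
    have "b \<in> sym_class q a"
      using that cyclotomic_class_self[of b q] unfolding h_S by blast
    then show ?thesis using cyclotomic_class_eq[OF q] by blast
  qed
  have disj: "?S a \<noteq> ?S b" if "?S a = ?S (- a)" "?S b \<noteq> ?S (- b)" for a b
    using that S_neg by metis
  have "range (sym_class q) = h ` ?I \<union> h ` ?II"
    unfolding type_I_classes_def type_II_classes_def h_S[symmetric] by blast
  moreover have "h ` ?I \<inter> h ` ?II = {}"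
  proof -
    have "h (?S a) \<noteq> h (?S b)" if "?S a = ?S (- a)" "?S b \<noteq> ?S (- b)" for a b
      using h_eq[of a b] disj[OF that] that by auto
    then show ?thesis unfolding type_I_classes_def type_II_classes_def by blast
  qed
  ultimately have "card (range (sym_class q :: 'a \<Rightarrow> 'a set)) = card (h ` ?I) + card (h ` ?II)"
    by (simp add: card_Un_disjoint)
  moreover have "card (h ` ?I) = m"
  proof -
    have "h T = T" if T: "T \<in> ?I" for T
    proof -
      obtain a where "T = ?S a" "?S a = ?S (- a)"
        using T unfolding type_I_classes_def by blast
      then show ?thesis using h_S[of a] by (metis Un_absorb)
    qed
    then have "h ` ?I = id ` ?I" by (intro image_cong refl) simp
    then show ?thesis using I by (simp only: image_id id_apply)
  qed
  moreover have "2 * n = card (h ` ?II) * 2"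
  proof -
    have two: "card {T \<in> ?II. h T = U} = 2" if U: "U \<in> h ` ?II" for U
    proof -
      obtain a where a: "U = h (?S a)" "?S a \<noteq> ?S (- a)"
        using U by (auto simp: type_II_classes_def)
      have "h (?S (- a)) = U" by (simp add: a h_S Un_commute)
      moreover have "?S a \<in> ?II" "?S (- a) \<in> ?II"
        unfolding type_II_classes_def using a(2) by (blast, force)
      moreover have "T = ?S a \<or> T = ?S (- a)" if T: "T \<in> ?II" "h T = U" for T
      proof -
        obtain b where "T = ?S b" using T by (auto simp: type_II_classes_def)
        then show ?thesis using h_eq[of a b] T a by simp
      qed
      ultimately have "{T \<in> ?II. h T = U} = {?S a, ?S (- a)}"
        using a(1) by blast
      then show ?thesis using a by simp
    qed
    have "card ?II = (\<Sum>U\<in>h ` ?II. card {T \<in> ?II. h T = U})"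
      using sum.image_gen[of ?II "\<lambda>_. 1::nat" h] by simp
    then show ?thesis using II two by simp
  qed
  ultimately show ?thesis by simp
qed

text \<open>Such functions factor uniquely through the range of \<open>k\<close>; choosing a
  preimage for each value recovers the factor.\<close>

lemma card_functions_constant_on_fibres:
  fixes k :: "'a::finite \<Rightarrow> 'k"
  shows "card {f :: 'a \<Rightarrow> 'f::finite. \<forall>x y. k x = k y \<longrightarrow> f x = f y}
    = CARD('f) ^ card (range k)"
proof -
  let ?F = "{f :: 'a \<Rightarrow> 'f. \<forall>x y. k x = k y \<longrightarrow> f x = f y}"
  have "bij_betw (\<lambda>\<phi>. \<phi> \<circ> k) (range k \<rightarrow>\<^sub>E (UNIV :: 'f set)) ?F"
    unfolding bij_betw_def
  proof
    show "inj_on (\<lambda>\<phi>. \<phi> \<circ> k) (range k \<rightarrow>\<^sub>E (UNIV :: 'f set))"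
    proof (rule inj_onI)
      fix \<phi> \<psi> assume \<phi>: "\<phi> \<in> range k \<rightarrow>\<^sub>E (UNIV :: 'f set)"
        and \<psi>: "\<psi> \<in> range k \<rightarrow>\<^sub>E (UNIV :: 'f set)" and eq: "\<phi> \<circ> k = \<psi> \<circ> k"
      show "\<phi> = \<psi>"
      proof (rule PiE_ext[OF \<phi> \<psi>])
        fix y assume "y \<in> range k"
        then obtain a where "y = k a" by blast
        then show "\<phi> y = \<psi> y" using fun_cong[OF eq, of a] by simp
      qed
    qed
    show "(\<lambda>\<phi>. \<phi> \<circ> k) ` (range k \<rightarrow>\<^sub>E (UNIV :: 'f set)) = ?F"
    proof safe
      fix f :: "'a \<Rightarrow> 'f" assume f: "\<forall>x y. k x = k y \<longrightarrow> f x = f y"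
      define \<phi> where "\<phi> = restrict (f \<circ> inv_into UNIV k) (range k)"
      have "f x = (\<phi> \<circ> k) x" for x
      proof -
        have "k (inv_into UNIV k (k x)) = k x" by (rule f_inv_into_f) simp
        then have "f (inv_into UNIV k (k x)) = f x" using f by blast
        then show ?thesis by (simp add: \<phi>_def)
      qed
      then have "f = \<phi> \<circ> k" by (rule ext)
      moreover have "\<phi> \<in> range k \<rightarrow>\<^sub>E UNIV" by (simp add: \<phi>_def)
      ultimately show "f \<in> (\<lambda>\<phi>. \<phi> \<circ> k) ` (range k \<rightarrow>\<^sub>E UNIV)" by (rule image_eqI)
    qed simp
  qed
  then show ?thesis
    by (simp add: bij_betw_same_card[symmetric] card_funcsetE)
qed

section \<open>Support and invariance of the solutions of u^q = u\<close>

section \<open>Elements fixed by the Frobenius map\<close>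

lemma power_card_power_eq:
  fixes c :: "'r::monoid_mult"
  assumes "c ^ q = c"
  shows "c ^ (q ^ n) = c"
  by (induction n) (simp_all add: assms power_mult)

text \<open>Field elements are fixed by q-th powers, so only the group elements move.\<close>

lemma lookup_power_card:
  fixes u :: "('f::{field, finite}, 'g::{ab_group_add, finite}) group_algebra"
  assumes p: "Factorial_Ring.prime p" and card: "CARD('f) = p ^ \<nu>"
  shows "Poly_Mapping.lookup (u ^ (p ^ \<nu>) ^ n) h
    = (\<Sum>g | nat_mult ((p ^ \<nu>) ^ n) g = h. Poly_Mapping.lookup u g)"
proof -
  have "c ^ (p ^ \<nu>) ^ n = c" for c :: 'f
    by (rule power_card_power_eq) (metis card finite_field_power_card)
  then show ?thesis
    using lookup_power_char[OF p CHAR_finite_field[OF p card], of u "\<nu> * n"]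
    by (simp flip: power_mult)
qed

text \<open>A high power of q annihilates the p-group, which confines the support to pairs
  \<open>(a, 0)\<close>. On such elements the q-th power moves the coefficient at a to q a, as
  multiplication by q is injective on the first factor.\<close>

lemma frobenius_fixed_iff:
  fixes u :: "('f::{field, finite}, 'a::{ab_group_add, finite} \<times> 'p::{ab_group_add, finite}) group_algebra"
  assumes p: "Factorial_Ring.prime p" and \<nu>: "\<nu> > 0" and card: "CARD('f) = p ^ \<nu>"
    and A: "\<not> p dvd CARD('a)" and P: "CARD('p) = p ^ k"
  shows "u ^ (p ^ \<nu>) = u \<longleftrightarrow>
    (\<forall>a x. x \<noteq> 0 \<longrightarrow> Poly_Mapping.lookup u (a, x) = 0) \<and>
    (\<forall>a. Poly_Mapping.lookup u (nat_mult (p ^ \<nu>) a, 0) = Poly_Mapping.lookup u (a, 0))"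
    (is "?L \<longleftrightarrow> ?supp \<and> ?inv")
proof -
  let ?q = "p ^ \<nu>"
  have "coprime p CARD('a)" using p A by (simp add: prime_imp_coprime)
  moreover have "?q > 0" using p prime_gt_0_nat by simp
  ultimately obtain N where N: "N > 0" "\<And>a :: 'a. nat_mult (?q ^ N) a = a"
    using ex_power_nat_mult_id[of ?q, where ?'a = 'a] by auto
  have inj: "a = b" if "nat_mult ?q a = nat_mult ?q b" for a b :: 'a
  proof -
    have "?q ^ N = ?q ^ (N - 1) * ?q" using N by (metis power_minus_mult)
    then show ?thesis using that N(2) nat_mult_mult by metis
  qed
  have push: "Poly_Mapping.lookup (u ^ ?q) (nat_mult ?q a, 0) = Poly_Mapping.lookup u (a, 0)"
    if ?supp for a
  proof -
    have "Poly_Mapping.lookup (u ^ ?q) (nat_mult ?q a, 0)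
        = (\<Sum>g | nat_mult ?q g = (nat_mult ?q a, 0). Poly_Mapping.lookup u g)"
      using lookup_power_card[OF p card, of u 1] by simp
    also have "\<dots> = (\<Sum>g\<in>{(a, 0)}. Poly_Mapping.lookup u g)"
    proof (rule sum.mono_neutral_right)
      show "\<forall>g\<in>{g. nat_mult ?q g = (nat_mult ?q a, 0)} - {(a, 0)}. Poly_Mapping.lookup u g = 0"
      proof
        fix g :: "'a \<times> 'p" assume g: "g \<in> {g. nat_mult ?q g = (nat_mult ?q a, 0)} - {(a, 0)}"
        obtain b x where bx: "g = (b, x)" by force
        with g have "b = a" "x \<noteq> 0" using inj by (auto simp: nat_mult_Pair)
        then show "Poly_Mapping.lookup u g = 0" using \<open>?supp\<close> bx by simp
      qed
    qed (auto simp: nat_mult_Pair)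
    finally show ?thesis by simp
  qed
  show ?thesis
  proof
    assume L: ?L
    \<comment> \<open>Any exponent at least \<open>k\<close> annihilates the p-group;
      \<open>N * k\<close> qualifies since \<open>N > 0\<close>.\<close>
    have "?q ^ (N * k) = p ^ (\<nu> * (N * k))" by (simp add: power_mult)
    moreover have "k \<le> \<nu> * (N * k)" using \<nu> N(1) by simp
    ultimately have "CARD('p) dvd ?q ^ (N * k)" unfolding P by (simp add: le_imp_power_dvd)
    then have kill: "nat_mult (?q ^ (N * k)) x = 0" for x :: 'p
      by (rule nat_mult_card_dvd)
    have supp: ?supp
    proof (intro allI impI)
      fix a :: 'a and x :: 'p assume "x \<noteq> 0"
      have "Poly_Mapping.lookup u (a, x) = Poly_Mapping.lookup (u ^ ?q ^ (N * k)) (a, x)"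
        using power_card_power_eq[OF L] by simp
      also have "\<dots> = (\<Sum>g | nat_mult (?q ^ (N * k)) g = (a, x). Poly_Mapping.lookup u g)"
        by (rule lookup_power_card[OF p card])
      also have "{g. nat_mult (?q ^ (N * k)) g = (a, x)} = {}"
        using \<open>x \<noteq> 0\<close> kill by (auto simp: nat_mult_Pair)
      finally show "Poly_Mapping.lookup u (a, x) = 0" by simp
    qed
    then show "?supp \<and> ?inv" using push[OF supp] L by simp
  next
    assume R: "?supp \<and> ?inv"
    show ?L
    proof (rule poly_mapping_eqI)
      fix g :: "'a \<times> 'p"
      obtain b x where g: "g = (b, x)" by force
      show "Poly_Mapping.lookup (u ^ ?q) g = Poly_Mapping.lookup u g"
      proof (cases "x = 0")
        case True
        have "b \<in> range (nat_mult ?q :: 'a \<Rightarrow> 'a)"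
          using inj finite_UNIV_inj_surj[of "nat_mult ?q :: 'a \<Rightarrow> 'a"] by (simp add: inj_def)
        then obtain a where "b = nat_mult ?q a" by blast
        then show ?thesis using push R True g by simp
      next
        \<comment> \<open>Preimages of \<open>(b, x)\<close> have nonzero second component, hence
          lie outside the support.\<close>
        case False
        have "Poly_Mapping.lookup (u ^ ?q) g = (\<Sum>h | nat_mult ?q h = g. Poly_Mapping.lookup u h)"
          using lookup_power_card[OF p card, of u 1] by simp
        also have "\<dots> = 0"
        proof (rule sum.neutral, rule ballI)
          fix h assume h: "h \<in> {h. nat_mult ?q h = g}"
          obtain a y where "h = (a, y)" by force
          moreover from this have "y \<noteq> 0" using h g False by (auto simp: nat_mult_Pair)
          ultimately show "Poly_Mapping.lookup u h = 0" using R by simp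
        qed
        finally show ?thesis using R False g by simp
      qed
    qed
  qed
qed

text \<open>Constancy on orbits is invariance under the two generating maps, multiplication by
  \<open>q\<close> and negation.\<close>

lemma constant_on_sym_class_iff:
  fixes f :: "'a::{ab_group_add, finite} \<Rightarrow> 'b"
  assumes q: "coprime q CARD('a)" "q > 0"
  shows "(\<forall>x y. sym_class q x = sym_class q y \<longrightarrow> f x = f y) \<longleftrightarrow>
    (\<forall>a. f (nat_mult q a) = f a) \<and> (\<forall>a. f (- a) = f a)" (is "?L \<longleftrightarrow> ?R")
proof
  assume L: ?L
  have "sym_class q (- a) = sym_class q a" for a :: 'a by auto
  moreover have "sym_class q (nat_mult q a) = sym_class q a" for a :: 'a
    using cyclotomic_class_eq[OF q cyclotomic_class_mult_mem, of a]
      cyclotomic_class_eq[OF q cyclotomic_class_mult_mem, of "- a"]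
    by (simp add: nat_mult_uminus)
  ultimately show ?R using L by blast
next
  assume R: ?R
  have pow: "f (nat_mult (q ^ i) a) = f a" for i a
    by (induction i) (simp_all add: R nat_mult_mult)
  show ?L
  proof (intro allI impI)
    fix x y :: 'a assume "sym_class q x = sym_class q y"
    then have "x \<in> sym_class q y" using cyclotomic_class_self by blast
    then show "f x = f y" using pow R by (auto simp: cyclotomic_class_def)
  qed
qed

text \<open>Restriction to pairs \<open>(a, 0)\<close> is a bijection onto the functions constant on
  the sets \<open>sym_class\<close>, with extension by zero as inverse.\<close>

lemma card_frobenius_fixed_self_conjugate:
  assumes p: "Factorial_Ring.prime p" and \<nu>: "\<nu> > 0"
    and card: "CARD('f::{field, finite}) = p ^ \<nu>"
    and A: "\<not> p dvd CARD('a::{ab_group_add, finite})"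
    and P: "CARD('p::{ab_group_add, finite}) = p ^ k"
  shows "card {u :: ('f, 'a \<times> 'p) group_algebra. u ^ (p ^ \<nu>) = u \<and> conj_ga u = u}
    = (p ^ \<nu>) ^ card (range (sym_class (p ^ \<nu>) :: 'a \<Rightarrow> 'a set))"
proof -
  let ?q = "p ^ \<nu>"
  let ?B = "{u :: ('f, 'a \<times> 'p) group_algebra. u ^ ?q = u \<and> conj_ga u = u}"
  let ?F = "{f :: 'a \<Rightarrow> 'f. \<forall>x y. sym_class ?q x = sym_class ?q y \<longrightarrow> f x = f y}"
  have q: "coprime ?q CARD('a)" "?q > 0"
    using p A prime_gt_0_nat by (auto intro: prime_imp_coprime)
  note fixed = frobenius_fixed_iff[OF p \<nu> card A P] and F = constant_on_sym_class_iff[OF q]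
  have conj: "conj_ga u = u \<longleftrightarrow> (\<forall>g. Poly_Mapping.lookup u (- g) = Poly_Mapping.lookup u g)"
    for u :: "('f, 'a \<times> 'p) group_algebra"
    by (metis lookup_conj_ga poly_mapping_eqI)
  let ?ext = "\<lambda>f :: 'a \<Rightarrow> 'f. Abs_poly_mapping (\<lambda>(a, x :: 'p). if x = 0 then f a else 0)"
  have "bij_betw (\<lambda>u a. Poly_Mapping.lookup u (a, 0)) ?B ?F"
  proof (rule bij_betw_byWitness[where f' = ?ext])
    show "\<forall>u\<in>?B. ?ext (\<lambda>a. Poly_Mapping.lookup u (a, 0)) = u"
    proof
      fix u assume "u \<in> ?B"
      then have "Poly_Mapping.lookup u (a, x) = 0" if "x \<noteq> 0" for a x
        using that by (simp add: fixed)
      then show "?ext (\<lambda>a. Poly_Mapping.lookup u (a, 0)) = u"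
        by (intro poly_mapping_eqI) (simp split: prod.split)
    qed
    show "\<forall>f\<in>?F. (\<lambda>a. Poly_Mapping.lookup (?ext f) (a, 0)) = f"
    proof
      show "(\<lambda>a. Poly_Mapping.lookup (?ext f) (a, 0)) = f" for f by simp
    qed
    show "(\<lambda>u a. Poly_Mapping.lookup u (a, 0)) ` ?B \<subseteq> ?F"
    proof safe
      fix u :: "('f, 'a \<times> 'p) group_algebra" and x y :: 'a
      assume "u ^ ?q = u" "conj_ga u = u" and xy: "sym_class ?q x = sym_class ?q y"
      then have "\<forall>a. Poly_Mapping.lookup u (nat_mult ?q a, 0) = Poly_Mapping.lookup u (a, 0)"
        "\<forall>g. Poly_Mapping.lookup u (- g) = Poly_Mapping.lookup u g"
        using fixed[of u] conj[of u] by blast+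
      then have "\<forall>x y. sym_class ?q x = sym_class ?q y \<longrightarrow>
          Poly_Mapping.lookup u (x, 0) = Poly_Mapping.lookup u (y, 0)"
        unfolding F by (metis minus_zero uminus_Pair)
      then show "Poly_Mapping.lookup u (x, 0) = Poly_Mapping.lookup u (y, 0)"
        using xy by blast
    qed
    show "?ext ` ?F \<subseteq> ?B"
    proof (rule image_subsetI)
      fix f assume "f \<in> ?F"
      then have "(\<forall>a. f (nat_mult ?q a) = f a) \<and> (\<forall>a. f (- a) = f a)"
        unfolding mem_Collect_eq F .
      then show "?ext f \<in> ?B" by (simp add: fixed conj)
    qed
  qed
  then have "card ?B = card ?F" by (rule bij_betw_same_card)
  then show ?thesis by (simp only: card_functions_constant_on_fibres card)
qed

theorem corollary4p3:
  fixes p \<nu> r\<^sub>I r\<^sub>I\<^sub>I :: nat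
  assumes "Factorial_Ring.prime p"
    and "\<nu> > 0"
    and "CARD('f::{field, finite}) = p ^ \<nu>"
    and "\<not> p dvd CARD('a::{ab_group_add, finite})"
    and "\<exists>k. CARD('p::{ab_group_add, finite}) = p ^ k"
    and "card (type_I_classes (p ^ \<nu>) :: 'a set set) = r\<^sub>I"
    and "card (type_II_classes (p ^ \<nu>) :: 'a set set) = 2 * r\<^sub>I\<^sub>I"
  shows "card {C :: ('f, 'a \<times> 'p) group_algebra set.
           abelian_code C \<and> euclidean_complementary_dual C} = 2 ^ (r\<^sub>I + r\<^sub>I\<^sub>I)"
proof -
  note p = assms(1) and card = assms(3)
  let ?q = "p ^ \<nu>"
  let ?B = "{u :: ('f, 'a \<times> 'p) group_algebra. u ^ ?q = u \<and> conj_ga u = u}"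
  let ?\<iota> = "Poly_Mapping.single 0 :: 'f \<Rightarrow> ('f, 'a \<times> 'p) group_algebra"
  have q: "coprime ?q CARD('a)" "?q > 0"
    using assms(1,4) prime_gt_0_nat by (auto intro: prime_imp_coprime)
  have char: "CHAR(('f, 'a \<times> 'p) group_algebra) = p"
    using CHAR_finite_field[OF p card] by (simp add: CHAR_group_algebra)
  have field: "c ^ ?q = c" for c :: 'f
    by (metis card finite_field_power_card)
  interpret frobenius_fixed_subalgebra ?\<iota> ?B
  proof
    fix u v assume uv: "u \<in> ?B" "v \<in> ?B"
    \<comment> \<open>The exponent is a power of the characteristic, so the q-th power map is
      additive.\<close>
    have "(u + v) ^ ?q = u ^ ?q + v ^ ?q"
      by (rule freshmans_dream') (simp_all add: char p)
    then show "u + v \<in> ?B" using uv by (simp add: conj_ga_add)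
    show "u * v \<in> ?B" using uv by (simp add: conj_ga_mult power_mult_distrib)
  qed (simp_all add: finite_group_algebra single_add mult_single single_power conj_ga_single
      field card)
  obtain k where "CARD('p) = p ^ k" using assms(5) by blast
  then have "card ?B = CARD('f) ^ (r\<^sub>I + r\<^sub>I\<^sub>I)"
    using card_frobenius_fixed_self_conjugate[OF assms(1-4)] card_sym_classes[OF q assms(6,7)]
    by (simp add: card)
  then have "card {x \<in> ?B. x * x = x} = 2 ^ (r\<^sub>I + r\<^sub>I\<^sub>I)"
    by (rule card_idempotents)
  \<comment> \<open>Every idempotent is fixed by q-th powers, so the idempotents of
    \<open>?B\<close> are exactly the self-conjugate ones of the group algebra.\<close>
  moreover have "e ^ ?q = e" if "e * e = e" for e :: "('f, 'a \<times> 'p) group_algebra"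
  proof -
    have "e ^ Suc n = e" for n by (induction n) (simp_all add: that)
    then show ?thesis using q(2) by (metis Suc_pred)
  qed
  then have "{x \<in> ?B. x * x = x} = {e. e * e = e \<and> conj_ga e = e}" by auto
  ultimately show ?thesis by (simp add: card_complementary_dual_codes)
qed

end
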